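(* Let $V$ be a vector space equipped with an injective linear map $Y(\cdot,x):V\to(\mathrm{End}\,V)[[x,x^{-1}]]$, $v\mapsto Y(v,x)=\sum_{n\in\mathbb Z}v_nx^{-n-1}$, such that $Y(u,x)v\in V((x))$ for all $u,v\in V$. Then weak associativity together with vacuum-free skew-symmetry can replace the Jacobi identity in the definition of vacuum-free vertex algebra; that is, the Jacobi identity $$x_0^{-1}\delta\left(\frac{x_1-x_2}{x_0}\right)Y(u,x_1)Y(v,x_2)-x_0^{-1}\delta\left(\frac{-x_2+x_1}{x_0}\right)Y(v,x_2)Y(u,x_1)=x_1^{-1}\delta\left(\frac{x_2+x_0}{x_1}\right)Y(Y(u,x_0)v,x_2)$$ holds for all $u,v\in V$ if and only if both of the following hold: (weak associativity) for all $u,v,w\in V$ there exists an integer $m\ge0$ such that $(x_0+x_2)^{m}\left(Y(u,x_0+x_2)Y(v,x_2)w-Y(Y(u,x_0)v,x_2)w\right)=0$; (vacuum-free skew-symmetry) for all $u,v\in V$, $Y(Y(u,x_0)v,x_2)=Y(Y(v,-x_0)u,x_2+x_0)$.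
   Context: All vector spaces are over $\mathbb C$; formal variables commute. For a vector space $U$, $U[[x,x^{-1}]]$ is the space of all formal Laurent series $\sum_{n\in\mathbb Z}u_nx^n$ with $u_n\in U$; $U((x))$ is the subspace of series with $u_n=0$ for $n$ sufficiently negative. $\delta(x)=\sum_{n\in\mathbb Z}x^n$. Binomial expansion convention: for every $n\in\mathbb Z$, $(x+y)^n=\sum_{k\ge0}\binom nk x^{n-k}y^k$, i.e. binomials are expanded in nonnegative powers of the second-listed variable (likewise with signs, so $(x_1-x_2)^n$ is expanded in nonnegative powers of $x_2$ and $(-x_2+x_1)^n$ in nonnegative powers of $x_1$); this applies inside $\delta$ and to substitutions such as $F(x+y)$. The map $Y$ is extended coefficientwise to series: $Y(Y(u,x_0)v,x_2)=\sum_n Y(u_nv,x_2)x_0^{-n-1}$. A vacuum-free vertex algebra is a vector space $V$ with an injective linear map $Y(\cdot,x):V\to(\mathrm{End}\,V)[[x,x^{-1}]]$ such that $Y(u,x)v\in V((x))$ for all $u,v\in V$ and the Jacobi identity (displayed in the claim) holds for all $u,v\in V$. *)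

theory Defs
  imports Complex_Main "HOL-Library.Product_Plus" "HOL-Library.Groups_Big_Fun"
begin

text \<open>
  A formal Laurent series with coefficients in a type is the function sending an exponent to
  its coefficient: \<open>int \<Rightarrow> 'v\<close> in one variable, and \<open>int \<times> int \<Rightarrow> 'v\<close>,
  \<open>int \<times> int \<times> int \<Rightarrow> 'v\<close> in several.  A vertex operator map is
  \<open>Y :: 'v \<Rightarrow> int \<Rightarrow> 'v \<Rightarrow> 'v\<close>, where \<open>Y v p\<close> is the coefficient of \<open>x\<^sup>p\<close> in \<open>Y(v,x)\<close>; thus
  the mode \<open>v\<^sub>n\<close>, the coefficient of \<open>x\<close> to the power \<open>-n-1\<close>, is \<open>Y v (-n-1)\<close>.

  \<open>Sum_any\<close> is the sum of a family of finite support.  It is \<open>0\<close> on families of infinite support,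
  but none arises below once \<open>Y(u,x)v\<close> is lower truncated for all \<open>u\<close>, \<open>v\<close>: every
  operator-valued series is therefore evaluated at a vector \<open>w\<close> before coefficients are summed.
\<close>

definition lower_truncated :: "(int \<Rightarrow> 'v::zero) \<Rightarrow> bool" where
  "lower_truncated F \<longleftrightarrow> (\<exists>N. \<forall>n<N. F n = 0)"

definition series_mult ::
  "(complex \<Rightarrow> 'v \<Rightarrow> 'v) \<Rightarrow> ('i::ab_group_add \<Rightarrow> complex) \<Rightarrow> ('i \<Rightarrow> 'v::comm_monoid_add) \<Rightarrow> 'i \<Rightarrow> 'v" where
  "series_mult scale a F n = Sum_any (\<lambda>k. scale (a k) (F (n - k)))"

text \<open>
  \<open>binom_power \<sigma> \<tau> n (i, j)\<close> is the coefficient of \<open>x\<^sup>i y\<^sup>j\<close> in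
  \<open>(\<sigma> x + \<tau> y)\<^sup>n\<close>, expanded in nonnegative powers of the second variable \<open>y\<close>;
  \<open>\<sigma>\<close> and \<open>\<tau>\<close> will be \<open>1\<close> or \<open>-1\<close>.
\<close>

definition binom_power :: "complex \<Rightarrow> complex \<Rightarrow> int \<Rightarrow> int \<times> int \<Rightarrow> complex" where
  "binom_power \<sigma> \<tau> n = (\<lambda>(i, j).
     if j \<ge> 0 \<and> i = n - j then (of_int n gchoose nat j) * \<sigma> powi i * \<tau> powi j else 0)"

text \<open>The substitution \<open>F(x + y)\<close>: the coefficient of \<open>x\<^sup>i y\<^sup>j\<close> is at position \<open>(i, j)\<close>.\<close>

definition subst_add ::
  "(complex \<Rightarrow> 'v \<Rightarrow> 'v) \<Rightarrow> (int \<Rightarrow> 'v::comm_monoid_add) \<Rightarrow> int \<times> int \<Rightarrow> 'v" where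
  "subst_add scale F k = Sum_any (\<lambda>n. scale (binom_power 1 1 n k) (F n))"

definition subst_neg :: "(complex \<Rightarrow> 'v \<Rightarrow> 'v) \<Rightarrow> (int \<Rightarrow> 'v) \<Rightarrow> int \<Rightarrow> 'v" where
  "subst_neg scale F n = scale ((-1) powi n) (F n)"

definition formal_delta :: "int \<Rightarrow> complex" where
  "formal_delta n = 1"

text \<open>
  \<open>delta_binom \<sigma> \<tau> (h, i, j)\<close> is the coefficient of \<open>z\<^sup>h x\<^sup>i y\<^sup>j\<close> in
  \<open>z\<inverse> \<delta>((\<sigma> x + \<tau> y) / z)\<close>, that is, in the sum over all integers \<open>n\<close> of
  \<open>(\<sigma> x + \<tau> y)\<^sup>n\<close> times \<open>z\<close> to the power \<open>-n-1\<close>.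
\<close>

definition delta_binom :: "complex \<Rightarrow> complex \<Rightarrow> int \<times> int \<times> int \<Rightarrow> complex" where
  "delta_binom \<sigma> \<tau> = (\<lambda>(h, i, j).
     Sum_any (\<lambda>n. if h = - n - 1 then formal_delta n * binom_power \<sigma> \<tau> n (i, j) else 0))"

text \<open>
  In the Jacobi identity exponents are ordered as \<open>(x\<^sub>0, x\<^sub>1, x\<^sub>2)\<close>; in
  the other two axioms they are ordered as \<open>(x\<^sub>0, x\<^sub>2)\<close>.
\<close>

definition jacobi_identity ::
  "(complex \<Rightarrow> 'v \<Rightarrow> 'v) \<Rightarrow> ('v \<Rightarrow> int \<Rightarrow> 'v \<Rightarrow> 'v::ab_group_add) \<Rightarrow> 'v \<Rightarrow> 'v \<Rightarrow> bool" where
  "jacobi_identity scale Y u v \<longleftrightarrow> (\<forall>w k.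
     series_mult scale (\<lambda>(i0, i1, i2). delta_binom 1 (-1) (i0, i1, i2))
       (\<lambda>(i0, i1, i2). if i0 = 0 then Y u i1 (Y v i2 w) else 0) k
     - series_mult scale (\<lambda>(i0, i1, i2). delta_binom (-1) 1 (i0, i2, i1))
       (\<lambda>(i0, i1, i2). if i0 = 0 then Y v i2 (Y u i1 w) else 0) k
     = series_mult scale (\<lambda>(i0, i1, i2). delta_binom 1 1 (i1, i2, i0))
       (\<lambda>(i0, i1, i2). if i1 = 0 then Y (Y u i0 v) i2 w else 0) k)"

text \<open>\<open>Y(Y(u,x\<^sub>0)v,x\<^sub>2)w\<close>\<close>

definition iterate ::
  "('v \<Rightarrow> int \<Rightarrow> 'v \<Rightarrow> 'v) \<Rightarrow> 'v \<Rightarrow> 'v \<Rightarrow> 'v \<Rightarrow> int \<times> int \<Rightarrow> 'v" where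
  "iterate Y u v w = (\<lambda>(i0, i2). Y (Y u i0 v) i2 w)"

text \<open>\<open>Y(u,x\<^sub>0+x\<^sub>2)Y(v,x\<^sub>2)w\<close>\<close>

definition shifted_product ::
  "(complex \<Rightarrow> 'v \<Rightarrow> 'v) \<Rightarrow> ('v \<Rightarrow> int \<Rightarrow> 'v \<Rightarrow> 'v::comm_monoid_add) \<Rightarrow> 'v \<Rightarrow> 'v \<Rightarrow> 'v \<Rightarrow> int \<times> int \<Rightarrow> 'v" where
  "shifted_product scale Y u v w = (\<lambda>(i0, i2).
     Sum_any (\<lambda>l. subst_add scale (\<lambda>n. Y u n (Y v l w)) (i0, i2 - l)))"

text \<open>\<open>Y(Y(v,-x\<^sub>0)u,x\<^sub>2+x\<^sub>0)w\<close>, expanded in nonnegative powers of the shift \<open>x\<^sub>0\<close>\<close>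

definition shifted_iterate ::
  "(complex \<Rightarrow> 'v \<Rightarrow> 'v) \<Rightarrow> ('v \<Rightarrow> int \<Rightarrow> 'v \<Rightarrow> 'v::comm_monoid_add) \<Rightarrow> 'v \<Rightarrow> 'v \<Rightarrow> 'v \<Rightarrow> int \<times> int \<Rightarrow> 'v" where
  "shifted_iterate scale Y v u w = (\<lambda>(i0, i2).
     Sum_any (\<lambda>l. subst_add scale
       (\<lambda>n. Y (subst_neg scale (\<lambda>p. Y v p u) l) n w) (i2, i0 - l)))"

definition weak_associativity ::
  "(complex \<Rightarrow> 'v \<Rightarrow> 'v) \<Rightarrow> ('v \<Rightarrow> int \<Rightarrow> 'v \<Rightarrow> 'v::ab_group_add) \<Rightarrow> bool" where
  "weak_associativity scale Y \<longleftrightarrow> (\<forall>u v w. \<exists>m::int. m \<ge> 0 \<and> (\<forall>k.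
     series_mult scale (binom_power 1 1 m)
       (\<lambda>i. shifted_product scale Y u v w i - iterate Y u v w i) k = 0))"

definition vacuum_free_skew_symmetry ::
  "(complex \<Rightarrow> 'v \<Rightarrow> 'v) \<Rightarrow> ('v \<Rightarrow> int \<Rightarrow> 'v \<Rightarrow> 'v::ab_group_add) \<Rightarrow> bool" where
  "vacuum_free_skew_symmetry scale Y \<longleftrightarrow>
     (\<forall>u v w. iterate Y u v w = shifted_iterate scale Y v u w)"

end

theory Submission
  imports Defs
begin

text \<open>
  Fix \<open>u\<close>, \<open>v\<close>, \<open>w\<close> and let \<open>D(h,i,j)\<close> be the coefficient of
  \<open>x\<^sub>0\<^sup>h x\<^sub>1\<^sup>i x\<^sub>2\<^sup>j\<close> in the difference of the two sides of the Jacobi identity,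
  applied to \<open>w\<close>.  Each of its three delta functions is annihilated by
  \<open>x\<^sub>1 - x\<^sub>2 - x\<^sub>0\<close>, which for coefficients is the recurrence
  \<open>D(h-1,i,j) = D(h,i-1,j) - D(h,i,j-1)\<close> (\<open>delta_relation\<close>); in the end it is Pascal's rule.
  Both axioms are statements about slices of this array, and the recurrence does the rest.

  Weak associativity: for \<open>m \<ge> 0\<close> the residue of the Jacobi identity against \<open>x\<^sub>1\<^sup>m\<close> has in its
  first and third terms the two sides of weak associativity multiplied by
  \<open>(x\<^sub>0 + x\<^sub>2)\<^sup>m\<close> (\<open>associativity_iff\<close>).  The second term drops out once
  \<open>x\<^sub>1\<^sup>m Y(u,x\<^sub>1)w\<close> has only nonnegative powers.  Hence the axiom for \<open>u\<close>, \<open>v\<close>, \<open>w\<close> says that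
  \<open>D(h,i,j) = 0\<close> for all sufficiently negative \<open>i\<close>, with a bound that depends on neither \<open>h\<close>
  nor \<open>j\<close>.

  Skew-symmetry: exchanging \<open>(u,x\<^sub>1)\<close> with \<open>(v,x\<^sub>2)\<close> and negating \<open>x\<^sub>0\<close> reproduces the
  commutator side of the identity (\<open>commutator_term_swap\<close>).  That the iterate side has
  the same symmetry is, in the slice \<open>i = -1\<close>, literally vacuum-free skew-symmetry
  (\<open>skew_symmetry_iff\<close>), and by the recurrence this slice controls all the others
  (\<open>iterate_term_swap_if_skew_symmetric\<close>).

  Consequently the Jacobi identity implies both axioms by reading off slices.  Conversely,
  weak associativity for \<open>u\<close>, \<open>v\<close>, \<open>w\<close> makes \<open>D\<close> vanish for \<open>i\<close> sufficiently negative, and weak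
  associativity for \<open>v\<close>, \<open>u\<close>, \<open>w\<close>, carried over by skew-symmetry, makes it vanish for \<open>j\<close>
  sufficiently negative.  As the recurrence expresses \<open>D(h,i,j)\<close> by values with smaller \<open>i + j\<close>,
  it follows that \<open>D = 0\<close> (\<open>delta_relation_eq_zero_if_lower_truncated\<close>).  Only the
  triples \<open>u\<close>, \<open>v\<close>, \<open>w\<close> and \<open>v\<close>, \<open>u\<close>, \<open>w\<close> enter, so the exponent in weak associativity may depend on
  all three vectors.
\<close>

section \<open>Sums with binomial coefficients\<close>

text \<open>
  Every multi-indexed sum in the axioms is supported on a line parametrized by the expansion
  index \<open>s\<close> of one binomial; this turns it into a sum over \<open>s\<close>.  Should the supports be
  infinite, the equation is \<open>0 = 0\<close>.
\<close>
lemma Sum_any_reindex: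
  assumes left_inverse: "\<And>s. \<psi> (\<phi> s) = s"
    and support: "\<And>k. g k \<noteq> 0 \<Longrightarrow> \<phi> (\<psi> k) = k"
    and summand: "\<And>s. g (\<phi> s) = f s"
  shows "Sum_any g = Sum_any f"
proof -
  have "f (\<psi> k) = g k" if "g k \<noteq> 0" for k
    using summand [of "\<psi> k"] support [OF that] by simp
  then have "sum g {k. g k \<noteq> 0} = sum f {s. f s \<noteq> 0}"
    by (intro sum.reindex_bij_witness [where i = \<phi> and j = \<psi>])
      (simp_all add: left_inverse support summand)
  then show ?thesis
    by (simp only: Sum_any.expand_set)
qed

lemma Sum_any_eq_single:
  assumes "\<And>k. k \<noteq> l \<Longrightarrow> g k = 0"
  shows "Sum_any g = g l"
proof -
  have "Sum_any g = Sum_any (\<lambda>k. if k = l then g k else 0)"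
    using assms by (intro Sum_any.cong) auto
  also have "\<dots> = g l"
    by (rule Sum_any.delta)
  finally show ?thesis .
qed

lemma delta_binom_eq:
  "delta_binom \<sigma> \<tau> (h, i, j) = binom_power \<sigma> \<tau> (- h - 1) (i, j)"
  unfolding delta_binom_def prod.case
  by (subst Sum_any_eq_single [of "- h - 1"]) (auto simp: formal_delta_def)

lemma minus_one_powi_diff_nat:
  "(- 1 :: complex) powi (n - int s) = (- 1) powi n * (- 1) ^ s"
  by (simp add: power_int_diff power_int_of_nat field_simps flip: power_mult_distrib)

locale complex_vector_space = vector_space scale
  for scale :: "complex \<Rightarrow> 'v \<Rightarrow> 'v::ab_group_add"
begin

text \<open>
  All coefficients in question are of this one form: a power \<open>n\<close> of a binomial, expanded in its
  second variable, acting on the values \<open>f s\<close> that meet the \<open>s\<close>-th power of that variable.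
\<close>
definition binom_sum :: "int \<Rightarrow> (nat \<Rightarrow> 'v) \<Rightarrow> 'v" where
  "binom_sum n f = Sum_any (\<lambda>s. scale (of_int n gchoose s) (f s))"

lemma scale_Sum_any: "scale c (Sum_any f) = Sum_any (\<lambda>s. scale c (f s))"
proof (cases "c = 0")
  case False
  then have "{s. scale c (f s) \<noteq> 0} = {s. f s \<noteq> 0}" by simp
  then show ?thesis
    by (simp add: Sum_any.expand_set scale_sum_right)
qed simp

text \<open>
  There are two reasons for finiteness: the binomial coefficients vanish eventually if
  \<open>n \<ge> 0\<close>, which serves the powers \<open>(x\<^sub>0 + x\<^sub>2)\<^sup>m\<close> in weak associativity, and the values
  vanish eventually for the delta functions, by truncation of the vertex operators.
\<close>
lemma finite_binom_support:
  assumes "0 \<le> n \<or> (\<exists>K. \<forall>s\<ge>K. f s = 0)"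
  shows "finite {s. scale (of_int n gchoose s) (f s) \<noteq> 0}"
proof -
  obtain K where "\<And>s. s \<ge> K \<Longrightarrow> scale (of_int n gchoose s) (f s) = 0"
  proof (cases "0 \<le> n")
    case True
    then have "of_int n gchoose s = (0::complex)" if "s \<ge> Suc (nat n)" for s
      using that by (cases n rule: nonneg_int_cases) (simp_all flip: binomial_gbinomial)
    then show ?thesis using that by (metis scale_zero_left)
  next
    case False
    then show ?thesis using assms that by (metis scale_zero_right)
  qed
  then have "{s. scale (of_int n gchoose s) (f s) \<noteq> 0} \<subseteq> {..<K}"
    by (metis (mono_tags, lifting) lessThan_iff linorder_not_le mem_Collect_eq subsetI)
  then show ?thesis
    by (rule finite_subset) simp
qed

lemma binom_sum_zero [simp]: "binom_sum 0 f = f 0"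
  unfolding binom_sum_def by (subst Sum_any_eq_single [of 0]) (auto simp: gbinomial_0_left)

text \<open>Pascal's rule, the source of every recurrence below.\<close>
lemma binom_sum_Suc:
  assumes fin: "0 \<le> n \<or> (\<exists>K. \<forall>s\<ge>K. f s = 0)"
  shows "binom_sum (n + 1) f = binom_sum n f + binom_sum n (\<lambda>s. f (Suc s))"
proof -
  have fin': "0 \<le> n \<or> (\<exists>K. \<forall>s\<ge>K. f (Suc s) = 0)"
    using fin le_SucI by blast
  let ?c = "\<lambda>s. of_int n gchoose s :: complex"
  let ?g = "\<lambda>s. case s of 0 \<Rightarrow> 0 | Suc r \<Rightarrow> scale (?c r) (f s)"
  have split: "scale (of_int (n + 1) gchoose s) (f s) = scale (?c s) (f s) + ?g s" for s
    by (cases s) (simp_all add: gbinomial_Suc_Suc scale_left_distrib)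
  have supp: "{s. ?g s \<noteq> 0} = Suc ` {r. scale (?c r) (f (Suc r)) \<noteq> 0}"
    by (auto simp: image_iff gr0_conv_Suc split: nat.splits)
  have "Sum_any ?g = binom_sum n (\<lambda>s. f (Suc s))"
    unfolding binom_sum_def
    by (rule Sum_any_reindex [where \<phi> = Suc and \<psi> = "\<lambda>s. s - 1"])
      (auto split: nat.splits)
  moreover have "finite {s. ?g s \<noteq> 0}"
    unfolding supp using finite_binom_support [OF fin'] by simp
  ultimately show ?thesis
    unfolding binom_sum_def [of "n + 1"] split
    using finite_binom_support [OF fin] by (subst Sum_any.distrib) (simp_all only: binom_sum_def)
qed

lemma binom_sum_uminus: "binom_sum n (\<lambda>s. - f s) = - binom_sum n f"
proof -
  have "scale (- 1) (binom_sum n f) = binom_sum n (\<lambda>s. scale (- 1) (f s))"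
    unfolding binom_sum_def scale_Sum_any by (rule Sum_any.cong) (rule scale_left_commute)
  then show ?thesis by simp
qed

section \<open>Series annihilated by the delta-function relation\<close>

text \<open>
  For a series \<open>X\<close> with coefficient \<open>X h i j\<close> at \<open>x\<^sub>0\<^sup>h x\<^sub>1\<^sup>i x\<^sub>2\<^sup>j\<close> this is the
  equation \<open>x\<^sub>0 X = (x\<^sub>1 - x\<^sub>2) X\<close>.
\<close>
definition delta_relation :: "(int \<Rightarrow> int \<Rightarrow> int \<Rightarrow> 'v) \<Rightarrow> bool" where
  "delta_relation X \<longleftrightarrow> (\<forall>h i j. X (h - 1) i j = X h (i - 1) j - X h i (j - 1))"

lemma delta_relationD:
  "delta_relation X \<Longrightarrow> X (h - 1) i j = X h (i - 1) j - X h i (j - 1)"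
  by (simp add: delta_relation_def)

lemma delta_relation_diff:
  "delta_relation X \<Longrightarrow> delta_relation Z \<Longrightarrow> delta_relation (\<lambda>h i j. X h i j - Z h i j)"
  by (simp add: delta_relation_def algebra_simps)

text \<open>
  Exchanging \<open>x\<^sub>1\<close> with \<open>x\<^sub>2\<close> and negating \<open>x\<^sub>0\<close> changes the sign of both sides of
  \<open>x\<^sub>0 X = (x\<^sub>1 - x\<^sub>2) X\<close>.
\<close>
lemma delta_relation_swap:
  assumes "delta_relation X"
  shows "delta_relation (\<lambda>h i j. scale ((- 1) powi h) (X h j i))"
  unfolding delta_relation_def
proof (intro allI)
  fix h i j
  show "scale ((- 1) powi (h - 1)) (X (h - 1) j i)
    = scale ((- 1) powi h) (X h j (i - 1)) - scale ((- 1) powi h) (X h (j - 1) i)"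
    using minus_one_powi_diff_nat [of h 1]
    by (simp add: delta_relationD [OF assms, of h j i] scale_right_diff_distrib)
qed

text \<open>
  The relation computes the value at \<open>(h, i, j)\<close> from two values at \<open>h + 1\<close> with smaller \<open>i + j\<close>,
  so that induction on \<open>i + j\<close> ends in one of the two regions where \<open>X\<close> vanishes.  The exponent
  \<open>h\<close> grows without bound on the way, which is why the hypotheses must be uniform in \<open>h\<close>.
\<close>
lemma delta_relation_eq_zero_if_lower_truncated:
  assumes rel: "delta_relation X"
    and left: "\<And>h i j. i < M \<Longrightarrow> X h i j = 0"
    and right: "\<And>h i j. j < L \<Longrightarrow> X h i j = 0"
  shows "X h i j = 0"
proof (induction "nat (i + j - M - L)" arbitrary: h i j rule: less_induct)
  case less
  show ?case
  proof (cases "i < M \<or> j < L")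
    case False
    then have "X (h + 1) (i - 1) j = 0" "X (h + 1) i (j - 1) = 0"
      using left right less by (smt (verit) nat_less_eq_zless)+
    then show ?thesis
      using delta_relationD [OF rel, of "h + 1" i j] by simp
  qed (use left right in auto)
qed

text \<open>
  If \<open>X\<close> vanishes at \<open>h - 1\<close>, then at \<open>h\<close> its values depend only on \<open>i + j\<close>, and the line of
  constant \<open>i + j\<close> meets the slice \<open>i = r\<close>.
\<close>
lemma delta_relation_eq_zero_if_zero_at_slice:
  assumes rel: "delta_relation X"
    and trunc: "\<And>h i j. h < N \<Longrightarrow> X h i j = 0"
    and slice: "\<And>h j. X h r j = 0"
  shows "X h i j = 0"
proof (induction "nat (h + 1 - N)" arbitrary: h i j)
  case 0
  then show ?case using trunc by simp
next
  case (Suc n)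
  have prev: "X (h - 1) i j = 0" for i j
    using Suc.hyps(2) by (intro Suc.hyps(1)) simp
  have move: "X h (i - 1) j = X h i (j - 1)" for i j
    using delta_relationD [OF rel, of h i j] prev by simp
  have "\<forall>j. X h i j = 0"
  proof (induction i rule: int_induct [where k = r])
    case base
    then show ?case using slice by simp
  next
    case (step1 i)
    then show ?case using move [of "i + 1" "j + 1" for j] by simp
  next
    case (step2 i)
    then show ?case using move by simp
  qed
  then show ?case by simp
qed

lemma delta_relation_slice_downward:
  assumes rel: "delta_relation X" and slice: "\<And>h j. X h r j = 0" and "i \<le> r"
  shows "X h i j = 0"
proof -
  have "\<forall>h j. X h i j = 0"
    using \<open>i \<le> r\<close>
  proof (induction i rule: int_le_induct)
    case base
    then show ?case using slice by simp
  next
    case (step i)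
    then show ?case using delta_relationD [OF rel, of _ i] by (metis eq_iff_diff_eq_0)
  qed
  then show ?thesis by simp
qed

text \<open>
  Multiplying the slice \<open>i = -1\<close> by \<open>(x\<^sub>0 + x\<^sub>2)\<^sup>m\<close> gives the slice \<open>i = -m-1\<close>, because
  \<open>X\<close> satisfies \<open>(x\<^sub>0 + x\<^sub>2) X = x\<^sub>1 X\<close>.
\<close>
lemma binom_sum_slice:
  assumes rel: "delta_relation X"
  shows "binom_sum (int m) (\<lambda>s. X (h - int m + int s) (- 1) (j - int s)) = X h (- int m - 1) j"
proof (induction m arbitrary: h j)
  case (Suc m)
  have "binom_sum (int (Suc m)) (\<lambda>s. X (h - int (Suc m) + int s) (- 1) (j - int s))
    = binom_sum (int m) (\<lambda>s. X (h - 1 - int m + int s) (- 1) (j - int s))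
    + binom_sum (int m) (\<lambda>s. X (h - int m + int s) (- 1) (j - 1 - int s))"
    using binom_sum_Suc [of "int m" "\<lambda>s. X (h - 1 - int m + int s) (- 1) (j - int s)"]
    by (simp add: algebra_simps)
  also have "\<dots> = X (h - 1) (- int m - 1) j + X h (- int m - 1) (j - 1)"
    by (simp only: Suc.IH)
  also have "\<dots> = X h (- int (Suc m) - 1) j"
    using delta_relationD [OF rel, of h "- int m - 1" j] by (simp add: algebra_simps)
  finally show ?case .
qed simp

lemma series_mult_binom_power:
  "series_mult scale (binom_power 1 1 m) F (h, j)
    = binom_sum m (\<lambda>s. F (h - m + int s, j - int s))"
  unfolding series_mult_def binom_sum_def
  by (rule Sum_any_reindex [where \<phi> = "\<lambda>s. (m - int s, int s)" and \<psi> = "\<lambda>(_, q). nat q"])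
    (auto simp: binom_power_def algebra_simps split: if_splits)

section \<open>The three terms of the Jacobi identity\<close>

text \<open>
  The coefficients of \<open>x\<^sub>0\<inverse> \<delta>((x\<^sub>1 - x\<^sub>2)/x\<^sub>0) a(x\<^sub>1,x\<^sub>2)\<close> at
  \<open>x\<^sub>0\<^sup>h x\<^sub>1\<^sup>i x\<^sub>2\<^sup>j\<close>.
\<close>
definition product_term :: "(int \<Rightarrow> int \<Rightarrow> 'v) \<Rightarrow> int \<Rightarrow> int \<Rightarrow> int \<Rightarrow> 'v" where
  "product_term a h i j =
     binom_sum (- h - 1) (\<lambda>s. scale ((- 1) ^ s) (a (i + h + 1 + int s) (j - int s)))"

text \<open>
  The coefficients of \<open>x\<^sub>1\<inverse> \<delta>((x\<^sub>2 + x\<^sub>0)/x\<^sub>1) c(x\<^sub>0,x\<^sub>2)\<close> at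
  \<open>x\<^sub>0\<^sup>h x\<^sub>1\<^sup>i x\<^sub>2\<^sup>j\<close>.
\<close>
definition iterate_term :: "(int \<Rightarrow> int \<Rightarrow> 'v) \<Rightarrow> int \<Rightarrow> int \<Rightarrow> int \<Rightarrow> 'v" where
  "iterate_term c h i j = binom_sum (- i - 1) (\<lambda>s. c (h - int s) (j + i + 1 + int s))"

lemma delta_relation_product_term:
  assumes "\<And>p q. q < N \<Longrightarrow> a p q = 0"
  shows "delta_relation (product_term a)"
  unfolding delta_relation_def
proof (intro allI)
  fix h i j
  let ?f = "\<lambda>s. scale ((- 1) ^ s) (a (i + h + int s) (j - int s))"
  have "\<exists>K. \<forall>s\<ge>K. ?f s = 0"
    using assms by (intro exI [of _ "nat (j - N + 1)"]) auto
  then have "binom_sum (- h - 1 + 1) ?f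
      = binom_sum (- h - 1) ?f + binom_sum (- h - 1) (\<lambda>s. ?f (Suc s))"
    by (intro binom_sum_Suc disjI2)
  then show "product_term a (h - 1) i j = product_term a h (i - 1) j - product_term a h i (j - 1)"
    by (simp add: product_term_def binom_sum_uminus algebra_simps)
qed

lemma delta_relation_iterate_term:
  assumes "\<And>p q. p < N \<Longrightarrow> c p q = 0"
  shows "delta_relation (iterate_term c)"
  unfolding delta_relation_def
proof (intro allI)
  fix h i j
  let ?f = "\<lambda>s. c (h - int s) (j + i + int s)"
  have "\<exists>K. \<forall>s\<ge>K. ?f s = 0"
    using assms by (intro exI [of _ "nat (h - N + 1)"]) auto
  then have "binom_sum (- i - 1 + 1) ?f
      = binom_sum (- i - 1) ?f + binom_sum (- i - 1) (\<lambda>s. ?f (Suc s))"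
    by (intro binom_sum_Suc disjI2)
  then show "iterate_term c (h - 1) i j = iterate_term c h (i - 1) j - iterate_term c h i (j - 1)"
    by (simp add: iterate_term_def algebra_simps)
qed

lemma product_term_eq_zero:
  assumes "\<And>p q. q < N \<Longrightarrow> a p q = 0" and "j < N"
  shows "product_term a h i j = 0"
  using assms by (simp add: product_term_def binom_sum_def)

lemma iterate_term_eq_zero:
  assumes "\<And>p q. p < N \<Longrightarrow> c p q = 0" and "h < N"
  shows "iterate_term c h i j = 0"
  using assms by (simp add: iterate_term_def binom_sum_def)

lemma iterate_term_at_minus_one [simp]: "iterate_term c h (- 1) j = c h j"
  by (simp add: iterate_term_def)

lemma series_mult_product_term:
  "series_mult scale (\<lambda>(i0, i1, i2). delta_binom 1 (- 1) (i0, i1, i2))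
     (\<lambda>(i0, i1, i2). if i0 = 0 then a i1 i2 else 0) (h, i, j) = product_term a h i j"
  unfolding series_mult_def product_term_def binom_sum_def
  by (rule Sum_any_reindex [where \<phi> = "\<lambda>s. (h, - h - 1 - int s, int s)"
      and \<psi> = "\<lambda>(_, _, q). nat q"])
    (auto simp: delta_binom_eq binom_power_def algebra_simps split: if_splits)

text \<open>
  Because of \<open>(-x\<^sub>2 + x\<^sub>1)\<^sup>n = (-1)\<^sup>n (x\<^sub>2 - x\<^sub>1)\<^sup>n\<close>, the second term of the Jacobi identity
  is the first one with \<open>x\<^sub>1\<close> and \<open>x\<^sub>2\<close> exchanged; with \<open>n = -h-1\<close> the sign is \<open>-(-1)\<^sup>h\<close>.
\<close>
lemma series_mult_opposite_product_term:
  "series_mult scale (\<lambda>(i0, i1, i2). delta_binom (- 1) 1 (i0, i2, i1))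
     (\<lambda>(i0, i1, i2). if i0 = 0 then b i2 i1 else 0) (h, i, j)
   = - scale ((- 1) powi h) (product_term b h j i)"
proof -
  have "series_mult scale (\<lambda>(i0, i1, i2). delta_binom (- 1) 1 (i0, i2, i1))
      (\<lambda>(i0, i1, i2). if i0 = 0 then b i2 i1 else 0) (h, i, j)
    = Sum_any (\<lambda>s. scale ((of_int (- h - 1) gchoose s) * (- 1) powi (- h - 1 - int s))
        (b (j + h + 1 + int s) (i - int s)))"
    unfolding series_mult_def
    by (rule Sum_any_reindex [where \<phi> = "\<lambda>s. (h, int s, - h - 1 - int s)"
        and \<psi> = "\<lambda>(_, q, _). nat q"])
      (auto simp: delta_binom_eq binom_power_def algebra_simps split: if_splits)
  moreover have sign: "(- 1 :: complex) powi (- h - 1) = - ((- 1) powi h)"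
    by (simp add: power_int_minus_left)
  moreover have "scale ((of_int (- h - 1) gchoose s) * (- 1) powi (- h - 1 - int s)) x
    = scale (- ((- 1) powi h)) (scale (of_int (- h - 1) gchoose s) (scale ((- 1) ^ s) x))" for s x
    by (simp add: minus_one_powi_diff_nat sign mult_ac)
  ultimately have "series_mult scale (\<lambda>(i0, i1, i2). delta_binom (- 1) 1 (i0, i2, i1))
      (\<lambda>(i0, i1, i2). if i0 = 0 then b i2 i1 else 0) (h, i, j)
    = scale (- ((- 1) powi h)) (product_term b h j i)"
    by (simp only: product_term_def binom_sum_def scale_Sum_any)
  then show ?thesis by simp
qed

lemma series_mult_iterate_term:
  "series_mult scale (\<lambda>(i0, i1, i2). delta_binom 1 1 (i1, i2, i0))
     (\<lambda>(i0, i1, i2). if i1 = 0 then c i0 i2 else 0) (h, i, j) = iterate_term c h i j"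
  unfolding series_mult_def iterate_term_def binom_sum_def
  by (rule Sum_any_reindex [where \<phi> = "\<lambda>s. (int s, i, - i - 1 - int s)"
      and \<psi> = "\<lambda>(q, _, _). nat q"])
    (auto simp: delta_binom_eq binom_power_def algebra_simps split: if_splits)

lemma Sum_any_subst_add:
  "Sum_any (\<lambda>l. subst_add scale (f l) (h, j - l))
    = Sum_any (\<lambda>s. scale (of_int (h + int s) gchoose s) (f (j - int s) (h + int s)))"
proof -
  have inner: "subst_add scale (f l) (h, j - l) = (if l \<le> j
    then scale (of_int (h + j - l) gchoose nat (j - l)) (f l (h + j - l)) else 0)" for l
    unfolding subst_add_def
    by (subst Sum_any_eq_single [of "h + j - l"]) (auto simp: binom_power_def)
  show ?thesis
    unfolding inner
    by (rule Sum_any_reindex [where \<phi> = "\<lambda>s. j - int s" and \<psi> = "\<lambda>l. nat (j - l)"])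
      (auto simp: add_diff_eq split: if_splits)
qed

text \<open>
  The bridge between the substitutions, whose coefficients are \<open>binomial(n+s, s)\<close>, and the delta
  functions, whose coefficients are \<open>binomial(-n-1, s)\<close>.
\<close>
lemma gbinomial_reflect:
  "of_int (n + int s) gchoose s = (- 1) ^ s * (of_int (- n - 1) gchoose s :: complex)"
  by (subst gbinomial_negated_upper) (simp add: algebra_simps)

text \<open>
  The coefficient of \<open>x\<^sub>1\<inverse>\<close> is the residue in \<open>x\<^sub>1\<close>, and taking it replaces \<open>x\<^sub>1\<close> by
  \<open>x\<^sub>0 + x\<^sub>2\<close>: the sum on the right has the coefficients of \<open>a(x\<^sub>0 + x\<^sub>2, x\<^sub>2)\<close>.
\<close>
lemma product_term_at_minus_one:
  "product_term a h (- 1) j = Sum_any (\<lambda>l. subst_add scale (\<lambda>n. a n l) (h, j - l))"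
  unfolding Sum_any_subst_add gbinomial_reflect product_term_def binom_sum_def
  by (simp add: mult.commute)

text \<open>
  Likewise the residue in \<open>x\<^sub>1\<close> turns the iterate term, after the exchange of \<open>x\<^sub>1\<close> with \<open>x\<^sub>2\<close>
  and the negation of \<open>x\<^sub>0\<close>, into \<open>c(-x\<^sub>0, x\<^sub>2 + x\<^sub>0)\<close>.
\<close>
lemma swapped_iterate_term_at_minus_one:
  "scale ((- 1) powi h) (iterate_term c h j (- 1))
    = Sum_any (\<lambda>l. subst_add scale (\<lambda>n. scale ((- 1) powi l) (c l n)) (j, h - l))"
proof -
  have "(- 1) ^ s * (- 1 :: complex) ^ s = 1" for s :: nat
    by (simp flip: power_mult_distrib)
  then show ?thesis
    unfolding Sum_any_subst_add gbinomial_reflect iterate_term_def binom_sum_def scale_Sum_any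
    by (simp add: minus_one_powi_diff_nat mult_ac)
qed

end

section \<open>Truncated vertex operators\<close>

locale vertex_operators = complex_vector_space scale
  for scale :: "complex \<Rightarrow> 'v \<Rightarrow> 'v::ab_group_add" +
  fixes Y :: "'v \<Rightarrow> int \<Rightarrow> 'v \<Rightarrow> 'v"
  assumes linear_operator: "\<And>v p. Vector_Spaces.linear scale scale (Y v p)"
    and linear_in_label: "\<And>p w. Vector_Spaces.linear scale scale (\<lambda>v. Y v p w)"
    and truncated: "\<And>u v. lower_truncated (\<lambda>p. Y u p v)"
begin

lemma Y_zero_right [simp]: "Y v p 0 = 0"
  and Y_zero_left [simp]: "Y 0 p w = 0"
  and Y_scale_left: "Y (scale c v) p w = scale c (Y v p w)"
  using linear_operator [of v p] linear_in_label [of p w]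
  by (simp_all add: linear_iff_module_hom module_hom.zero
      module_hom.zero [where f = "\<lambda>v. Y v p w"] module_hom.scale [where f = "\<lambda>v. Y v p w"])

definition operator_product :: "'v \<Rightarrow> 'v \<Rightarrow> 'v \<Rightarrow> int \<Rightarrow> int \<Rightarrow> 'v" where
  "operator_product u v w p q = Y u p (Y v q w)"

definition operator_iterate :: "'v \<Rightarrow> 'v \<Rightarrow> 'v \<Rightarrow> int \<Rightarrow> int \<Rightarrow> 'v" where
  "operator_iterate u v w p q = Y (Y u p v) q w"

definition commutator_term :: "'v \<Rightarrow> 'v \<Rightarrow> 'v \<Rightarrow> int \<Rightarrow> int \<Rightarrow> int \<Rightarrow> 'v" where
  "commutator_term u v w h i j = product_term (operator_product u v w) h i j
     + scale ((- 1) powi h) (product_term (operator_product v u w) h j i)"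

lemma operator_product_truncated:
  "\<exists>N. \<forall>p q. q < N \<longrightarrow> operator_product u v w p q = 0"
  using truncated [of v w] by (fastforce simp: lower_truncated_def operator_product_def)

lemma operator_iterate_truncated:
  "\<exists>N. \<forall>p q. p < N \<longrightarrow> operator_iterate u v w p q = 0"
  using truncated [of u v] by (fastforce simp: lower_truncated_def operator_iterate_def)

lemma delta_relation_operator_product:
  "delta_relation (product_term (operator_product u v w))"
  using operator_product_truncated [of u v w] delta_relation_product_term by blast

lemma delta_relation_operator_iterate:
  "delta_relation (iterate_term (operator_iterate u v w))"
  using operator_iterate_truncated [of u v w] delta_relation_iterate_term by blast

lemma delta_relation_commutator_term: "delta_relation (commutator_term u v w)"
  using delta_relation_operator_product [of u v w]
    delta_relation_swap [OF delta_relation_operator_product [of v u w]]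
  by (simp add: delta_relation_def commutator_term_def algebra_simps)

lemma jacobi_identity_iff:
  "jacobi_identity scale Y u v \<longleftrightarrow>
    (\<forall>w h i j. commutator_term u v w h i j = iterate_term (operator_iterate u v w) h i j)"
  using series_mult_product_term [of "operator_product u v w" for w]
    series_mult_opposite_product_term [of "operator_product v u w" for w]
    series_mult_iterate_term [of "operator_iterate u v w" for w]
  unfolding operator_product_def operator_iterate_def commutator_term_def jacobi_identity_def
  by (simp only: split_paired_All diff_minus_eq_add)

lemma commutator_term_swap:
  "commutator_term u v w h i j = scale ((- 1) powi h) (commutator_term v u w h j i)"
proof -
  have "(- 1) powi h * (- 1 :: complex) powi h = 1"
    by (simp flip: power_int_mult_distrib)
  then show ?thesis
    by (simp add: commutator_term_def scale_right_distrib add.commute)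
qed

text \<open>
  The difference of the first and the third term of the Jacobi identity satisfies the delta
  relation, and its slice \<open>i = -1\<close> is \<open>Y(u,x\<^sub>0+x\<^sub>2)Y(v,x\<^sub>2)w - Y(Y(u,x\<^sub>0)v,x\<^sub>2)w\<close>; so
  multiplication by \<open>(x\<^sub>0 + x\<^sub>2)\<^sup>m\<close> moves to the slice \<open>i = -m-1\<close>.
\<close>
lemma associativity_iff:
  "(\<forall>k. series_mult scale (binom_power 1 1 (int m))
      (\<lambda>i. shifted_product scale Y u v w i - iterate Y u v w i) k = 0) \<longleftrightarrow>
    (\<forall>h j. product_term (operator_product u v w) h (- int m - 1) j
      = iterate_term (operator_iterate u v w) h (- int m - 1) j)"
proof -
  let ?X = "\<lambda>h i j. product_term (operator_product u v w) h i j
    - iterate_term (operator_iterate u v w) h i j"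
  have "shifted_product scale Y u v w (h, j) - iterate Y u v w (h, j) = ?X h (- 1) j" for h j
    by (simp add: shifted_product_def iterate_def product_term_at_minus_one
        operator_product_def operator_iterate_def)
  moreover have "binom_sum (int m) (\<lambda>s. ?X (h - int m + int s) (- 1) (j - int s))
      = ?X h (- int m - 1) j" for h j
    by (intro binom_sum_slice delta_relation_diff
        delta_relation_operator_product delta_relation_operator_iterate)
  ultimately show ?thesis
    by (simp only: split_paired_all split_paired_All series_mult_binom_power right_minus_eq)
qed

lemma skew_symmetry_iff:
  "vacuum_free_skew_symmetry scale Y \<longleftrightarrow> (\<forall>u v w h j.
    operator_iterate u v w h j
      = scale ((- 1) powi h) (iterate_term (operator_iterate v u w) h j (- 1)))"
  by (simp add: vacuum_free_skew_symmetry_def fun_eq_iff iterate_def shifted_iterate_def subst_neg_def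
      swapped_iterate_term_at_minus_one operator_iterate_def Y_scale_left)

section \<open>Passing between the axioms and the Jacobi identity\<close>

text \<open>
  The iterates are truncated in \<open>x\<^sub>0\<close>, so the slice \<open>i = -1\<close>, which is the hypothesis,
  determines the whole array.
\<close>
lemma iterate_term_swap_if_skew_symmetric:
  assumes skew: "\<And>h j. operator_iterate u v w h j
    = scale ((- 1) powi h) (iterate_term (operator_iterate v u w) h j (- 1))"
  shows "iterate_term (operator_iterate u v w) h i j
    = scale ((- 1) powi h) (iterate_term (operator_iterate v u w) h j i)"
proof -
  let ?X = "\<lambda>h i j. iterate_term (operator_iterate u v w) h i j
    - scale ((- 1) powi h) (iterate_term (operator_iterate v u w) h j i)"
  obtain N where N: "\<And>p q. p < N \<Longrightarrow> operator_iterate u v w p q = 0"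
    using operator_iterate_truncated by blast
  obtain N' where N': "\<And>p q. p < N' \<Longrightarrow> operator_iterate v u w p q = 0"
    using operator_iterate_truncated by blast
  have "?X h i j = 0"
  proof (rule delta_relation_eq_zero_if_zero_at_slice [where X = ?X and r = "- 1" and N = "min N N'"])
    show "delta_relation ?X"
      by (intro delta_relation_diff delta_relation_swap delta_relation_operator_iterate)
    show "?X h i j = 0" if "h < min N N'" for h i j
      using that iterate_term_eq_zero [OF N] iterate_term_eq_zero [OF N'] by simp
    show "?X h (- 1) j = 0" for h j
      using skew by simp
  qed
  then show ?thesis by simp
qed

text \<open>
  A vanishing slice of the difference of the first and the third term propagates to all smaller
  exponents of \<open>x\<^sub>1\<close>, and there the second term vanishes too, by truncation of \<open>Y(u,x\<^sub>1)w\<close>.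
\<close>
lemma jacobi_holds_for_small_x1_exponents:
  assumes "\<And>h j. product_term (operator_product u v w) h (- int m - 1) j
    = iterate_term (operator_iterate u v w) h (- int m - 1) j"
  obtains M where "\<And>h i j. i < M \<Longrightarrow>
    commutator_term u v w h i j = iterate_term (operator_iterate u v w) h i j"
proof -
  obtain N where N: "\<And>p q. q < N \<Longrightarrow> operator_product v u w p q = 0"
    using operator_product_truncated by blast
  let ?X = "\<lambda>h i j. product_term (operator_product u v w) h i j
    - iterate_term (operator_iterate u v w) h i j"
  have "?X h i j = 0" if "i \<le> - int m - 1" for h i j
    by (rule delta_relation_slice_downward [where X = ?X, OF _ _ that])
      (use assms in \<open>auto intro: delta_relation_diff
        delta_relation_operator_product delta_relation_operator_iterate\<close>)
  then show ?thesis
    using product_term_eq_zero [OF N]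
    by (intro that [of "min N (- int m)"]) (simp add: commutator_term_def)
qed

lemma jacobi_if_associative_and_skew_symmetric:
  assumes assoc: "weak_associativity scale Y" and skew: "vacuum_free_skew_symmetry scale Y"
  shows "jacobi_identity scale Y u v"
  unfolding jacobi_identity_iff
proof (intro allI)
  fix w h i j
  have small: "\<exists>M. \<forall>h i j. i < M \<longrightarrow>
    commutator_term u v w h i j = iterate_term (operator_iterate u v w) h i j" for u v
  proof -
    obtain m where "m \<ge> 0" and m: "\<forall>k. series_mult scale (binom_power 1 1 m)
        (\<lambda>i. shifted_product scale Y u v w i - iterate Y u v w i) k = 0"
      using assoc unfolding weak_associativity_def by blast
    have "\<forall>h j. product_term (operator_product u v w) h (- int (nat m) - 1) j
      = iterate_term (operator_iterate u v w) h (- int (nat m) - 1) j"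
      using m \<open>m \<ge> 0\<close> associativity_iff [of "nat m" u v w] by simp
    then show ?thesis
      using jacobi_holds_for_small_x1_exponents by metis
  qed
  have swap: "iterate_term (operator_iterate u v w) h i j
    = scale ((- 1) powi h) (iterate_term (operator_iterate v u w) h j i)" for h i j
    using skew unfolding skew_symmetry_iff by (intro iterate_term_swap_if_skew_symmetric) blast
  obtain M where M: "\<And>h i j. i < M \<Longrightarrow>
      commutator_term u v w h i j = iterate_term (operator_iterate u v w) h i j"
    using small by blast
  \<comment> \<open>The same bound for \<open>v\<close>, \<open>u\<close> becomes, after the swap, a bound on the exponent of \<open>x\<^sub>2\<close>.\<close>
  obtain L where L: "\<And>h i j. i < L \<Longrightarrow>
      commutator_term v u w h i j = iterate_term (operator_iterate v u w) h i j"
    using small by blast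
  let ?D = "\<lambda>h i j. commutator_term u v w h i j - iterate_term (operator_iterate u v w) h i j"
  have "?D h i j = 0"
  proof (rule delta_relation_eq_zero_if_lower_truncated [where X = ?D and M = M and L = L])
    show "delta_relation ?D"
      by (intro delta_relation_diff delta_relation_commutator_term delta_relation_operator_iterate)
    show "?D h i j = 0" if "i < M" for h i j
      using M that by simp
    show "?D h i j = 0" if "j < L" for h i j
      using L [OF that] by (simp add: commutator_term_swap [of u v] swap)
  qed
  then show "commutator_term u v w h i j = iterate_term (operator_iterate u v w) h i j" by simp
qed

lemma weak_associativity_if_jacobi:
  assumes "\<And>u v. jacobi_identity scale Y u v"
  shows "weak_associativity scale Y"
  unfolding weak_associativity_def
proof (intro allI)
  fix u v w
  obtain N where N: "\<And>p q. q < N \<Longrightarrow> operator_product v u w p q = 0"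
    using operator_product_truncated by blast
  \<comment> \<open>The slice \<open>i = -m-1\<close> has to lie below \<open>N\<close>, where the second term of the Jacobi identity
    vanishes.\<close>
  define m where "m = nat (- N)"
  have "product_term (operator_product u v w) h (- int m - 1) j
      = iterate_term (operator_iterate u v w) h (- int m - 1) j" for h j
  proof -
    have "product_term (operator_product v u w) h j (- int m - 1) = 0"
      using N by (rule product_term_eq_zero) (simp_all only: m_def, arith)
    moreover have "commutator_term u v w h (- int m - 1) j
        = iterate_term (operator_iterate u v w) h (- int m - 1) j"
      using assms [of u v] unfolding jacobi_identity_iff by blast
    ultimately show ?thesis
      by (simp add: commutator_term_def)
  qed
  then show "\<exists>m::int. m \<ge> 0 \<and> (\<forall>k. series_mult scale (binom_power 1 1 m)
      (\<lambda>i. shifted_product scale Y u v w i - iterate Y u v w i) k = 0)"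
    by (intro exI [of _ "int m"]) (simp add: associativity_iff del: split_paired_All)
qed

lemma skew_symmetry_if_jacobi:
  assumes "\<And>u v. jacobi_identity scale Y u v"
  shows "vacuum_free_skew_symmetry scale Y"
  using assms commutator_term_swap
  unfolding skew_symmetry_iff jacobi_identity_iff by (metis iterate_term_at_minus_one)

end

theorem proposition4p4:
  fixes scale :: "complex \<Rightarrow> 'v \<Rightarrow> 'v::ab_group_add"
    and Y :: "'v \<Rightarrow> int \<Rightarrow> 'v \<Rightarrow> 'v"
  assumes "vector_space scale"
    and "\<And>v p. Vector_Spaces.linear scale scale (Y v p)"
    and "\<And>p w. Vector_Spaces.linear scale scale (\<lambda>v. Y v p w)"
    and "inj Y"
    and "\<And>u v. lower_truncated (\<lambda>p. Y u p v)"
  shows "(\<forall>u v. jacobi_identity scale Y u v) \<longleftrightarrow>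
    weak_associativity scale Y \<and> vacuum_free_skew_symmetry scale Y"
proof -
  interpret vertex_operators scale Y
    using assms(1,2,3,5)
    by (simp add: vertex_operators_def vertex_operators_axioms_def complex_vector_space_def)
  show ?thesis
    using jacobi_if_associative_and_skew_symmetric weak_associativity_if_jacobi
      skew_symmetry_if_jacobi by blast
qed

end
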